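(* Let $m\ge1$, let $k$ be an odd number with $1\le k\le m$ and let $R_m$ be a generic $m$-rosette with $k$-width $w_k$. Then $$\int_0^{2m\pi}\frac{w_k(\theta)}{\sqrt{1+w_k^2(\theta)}}\,d\theta=\int_0^{2m\pi}\bigl(w_k(\theta)+w_k''(\theta)\bigr)\cdot\frac{\sqrt{1+w_k^2(\theta)}}{1+w_k^2(\theta)+w_k'^2(\theta)}\,d\theta.$$
   Context: An $m$-rosette $R_m$ is a closed regular smooth curve in $\mathbb R^2$ with positive signed curvature and rotation number $m$. Its support function $p$ is the $2m\pi$-periodic smooth function such that $R_m$ is parametrized by $\gamma(\theta)=(p(\theta)\cos\theta-p'(\theta)\sin\theta,\;p(\theta)\sin\theta+p'(\theta)\cos\theta)$; one has $p+p''>0$. For $k\in\{1,\dots,m\}$ the $k$-width is $w_k(\theta)=p(\theta)-(-1)^kp(\theta+k\pi)$. "Generic" has its usual meaning in singularity theory: the assertion holds for all $R_m$ in some residual subset of the space of $m$-rosettes with the $C^\infty$ topology. *)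

theory Defs
  imports "HOL-Complex_Analysis.Complex_Analysis"
begin

text \<open>The plane is the type \<open>complex\<close>; closed curves are functions of period 1 on the real line.\<close>

definition iter_deriv :: "nat \<Rightarrow> (real \<Rightarrow> 'a::real_normed_vector) \<Rightarrow> real \<Rightarrow> 'a" where
  "iter_deriv j f = ((\<lambda>g t. vector_derivative g (at t)) ^^ j) f"

definition smooth :: "(real \<Rightarrow> 'a::real_normed_vector) \<Rightarrow> bool" where
  "smooth f \<longleftrightarrow> (\<forall>j t. iter_deriv j f differentiable (at t))"

definition smooth_closed_curves :: "(real \<Rightarrow> complex) set" where
  "smooth_closed_curves = {c. smooth c \<and> (\<forall>t. c (t + 1) = c t)}"

definition regular_curve :: "(real \<Rightarrow> complex) \<Rightarrow> bool" where
  "regular_curve c \<longleftrightarrow> (\<forall>t. iter_deriv 1 c t \<noteq> 0)"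

definition signed_curvature :: "(real \<Rightarrow> complex) \<Rightarrow> real \<Rightarrow> real" where
  "signed_curvature c t =
     (Re (iter_deriv 1 c t) * Im (iter_deriv 2 c t) - Im (iter_deriv 1 c t) * Re (iter_deriv 2 c t))
       / norm (iter_deriv 1 c t) ^ 3"

text \<open>The winding number is taken along the library's path domain \<open>{0..1}\<close>, i.e. one period.\<close>

definition rotation_number :: "(real \<Rightarrow> complex) \<Rightarrow> complex" where
  "rotation_number c = winding_number (iter_deriv 1 c) 0"

definition rosettes :: "nat \<Rightarrow> (real \<Rightarrow> complex) set" where
  "rosettes m = {c \<in> smooth_closed_curves. regular_curve c \<and>
     (\<forall>t. signed_curvature c t > 0) \<and> rotation_number c = of_nat m}"

text \<open>
  The \<open>C\<^sup>\<infinity>\<close> topology, i.e. uniform convergence of every derivative. Derivatives of closed curves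
  attain their maximal norm, so each generating set is an open ball for the seminorm
  \<open>sup\<^sub>t \<parallel>g\<^sup>(\<^sup>j\<^sup>)(t)\<parallel>\<close>.
\<close>

definition Cinf_topology :: "(real \<Rightarrow> complex) topology" where
  "Cinf_topology = topology_generated_by
     {{g \<in> smooth_closed_curves. \<forall>t. dist (iter_deriv j g t) (iter_deriv j f t) < e} | f j e.
        f \<in> smooth_closed_curves \<and> e > 0}"

definition rosette_space :: "nat \<Rightarrow> (real \<Rightarrow> complex) topology" where
  "rosette_space m = subtopology Cinf_topology (rosettes m)"

definition residual_in :: "'a topology \<Rightarrow> 'a set \<Rightarrow> bool" where
  "residual_in X G \<longleftrightarrow> G \<subseteq> topspace X \<and>
     (\<exists>\<U>. countable \<U> \<and> (\<forall>U\<in>\<U>. openin X U \<and> X closure_of U = topspace X)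
         \<and> topspace X \<inter> \<Inter>\<U> \<subseteq> G)"

definition support_param :: "(real \<Rightarrow> real) \<Rightarrow> real \<Rightarrow> complex" where
  "support_param p \<theta> = Complex (p \<theta> * cos \<theta> - deriv p \<theta> * sin \<theta>) (p \<theta> * sin \<theta> + deriv p \<theta> * cos \<theta>)"

text \<open>
  \<open>p\<close> is a support function of the \<open>m\<close>-rosette \<open>c\<close>: \<open>c\<close> is \<open>support_param p\<close> up to an orientation
  preserving reparametrization \<open>\<phi>\<close>, one period of \<open>c\<close> corresponding to the period \<open>2m\<pi>\<close> of \<open>p\<close>.
  The condition \<open>p + p'' > 0\<close> selects the outward normal: \<open>\<theta> \<mapsto> - p (\<theta> + \<pi>)\<close> parametrizes the same
  curve by its inward normal. What remains is the choice of the base value of the normal angle,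
  a shift of \<open>p\<close> by a multiple of \<open>2\<pi>\<close>.
\<close>

definition is_support_function :: "nat \<Rightarrow> (real \<Rightarrow> complex) \<Rightarrow> (real \<Rightarrow> real) \<Rightarrow> bool" where
  "is_support_function m c p \<longleftrightarrow>
     smooth p \<and> (\<forall>\<theta>. p (\<theta> + 2 * real m * pi) = p \<theta>) \<and>
     (\<forall>\<theta>. p \<theta> + deriv (deriv p) \<theta> > 0) \<and>
     (\<exists>\<phi> :: real \<Rightarrow> real. smooth \<phi> \<and> (\<forall>t. deriv \<phi> t > 0) \<and>
        (\<forall>t. \<phi> (t + 1) = \<phi> t + 2 * real m * pi) \<and> (\<forall>t. c t = support_param p (\<phi> t)))"

definition k_width :: "(real \<Rightarrow> real) \<Rightarrow> nat \<Rightarrow> real \<Rightarrow> real" where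
  "k_width p k \<theta> = p \<theta> - (- 1) ^ k * p (\<theta> + real k * pi)"

lemma topspace_rosette_space: "topspace (rosette_space m) = rosettes m"
proof -
  have "topspace Cinf_topology = smooth_closed_curves"
  proof
    show "topspace Cinf_topology \<subseteq> smooth_closed_curves"
      by (auto simp: Cinf_topology_def)
    show "smooth_closed_curves \<subseteq> topspace Cinf_topology"
    proof
      fix f assume f: "f \<in> smooth_closed_curves"
      let ?B = "{g \<in> smooth_closed_curves. \<forall>t. dist (iter_deriv 0 g t) (iter_deriv 0 f t) < 1}"
      have "f \<in> ?B" using f by simp
      moreover have "openin Cinf_topology ?B"
        unfolding Cinf_topology_def
        by (rule topology_generated_by_Basis) (use f zero_less_one in blast)
      ultimately show "f \<in> topspace Cinf_topology"
        using openin_subset by blast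
    qed
  qed
  then show ?thesis
    by (auto simp: rosette_space_def rosettes_def)
qed

end

theory Submission
  imports Defs
begin

text \<open>
  The difference of the two integrands is the derivative of the \<open>T\<close>-periodic function
  \<open>arctan (w' / sqrt (1 + w\<^sup>2))\<close>, so its integral over a period vanishes.
\<close>

text \<open>The empty family of open dense sets serves as witness, since its intersection is
  \<open>UNIV\<close>.\<close>

lemma residual_in_topspace: "residual_in X (topspace X)"
  unfolding residual_in_def by (intro conjI subset_refl exI[of _ "{}"]) auto

lemma iter_deriv_Suc: "iter_deriv (Suc j) f t = vector_derivative (iter_deriv j f) (at t)"
  by (simp add: iter_deriv_def)

lemma smooth_DERIV_iter_deriv:
  fixes f :: "real \<Rightarrow> real"
  assumes "smooth f"
  shows "(iter_deriv j f has_real_derivative iter_deriv (Suc j) f t) (at t)"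
  using assms
  by (simp add: smooth_def iter_deriv_Suc vector_derivative_works
      has_real_derivative_iff_has_vector_derivative)

text \<open>Passes from iterated vector derivatives to the real derivatives used in the calculus
  below; the integrands involve derivatives up to second order.\<close>

lemma smooth_DERIV_twice:
  fixes f :: "real \<Rightarrow> real"
  assumes "smooth f"
  obtains f' f'' where
    "\<And>t. (f has_real_derivative f' t) (at t)" "\<And>t. (f' has_real_derivative f'' t) (at t)"
proof
  show "(f has_real_derivative iter_deriv 1 f t) (at t)" for t
    using smooth_DERIV_iter_deriv[OF assms, of 0] by (simp add: iter_deriv_def)
  show "(iter_deriv 1 f has_real_derivative iter_deriv 2 f t) (at t)" for t
    using smooth_DERIV_iter_deriv[OF assms, of 1] by (simp add: numeral_2_eq_2)
qed

text \<open>The shift by \<open>real k * pi\<close> and the sign \<open>(- 1) ^ k\<close> are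
  constants, so differentiation commutes with forming the width. Applied to \<open>p\<close> and
  then to \<open>p'\<close>, this yields both derivatives of the width.\<close>

lemma DERIV_k_width:
  assumes "\<And>t. (p has_real_derivative p' t) (at t)"
  shows "(k_width p k has_real_derivative k_width p' k t) (at t)"
proof -
  have "((\<lambda>t. p (t + real k * pi)) has_real_derivative p' (t + real k * pi)) (at t)"
    by (rule iffD1[OF DERIV_shift assms])
  from DERIV_diff[OF assms DERIV_cmult[OF this]] show ?thesis
    by (simp add: k_width_def[abs_def])
qed

lemma k_width_periodic:
  assumes "\<And>t. p (t + T) = p t"
  shows "k_width p k (t + T) = k_width p k t"
  using assms[of t] assms[of "t + real k * pi"] by (simp add: k_width_def algebra_simps)

lemma periodic_DERIV:
  fixes f :: "real \<Rightarrow> real"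
  assumes per: "\<And>t. f (t + T) = f t" and der: "\<And>t. (f has_real_derivative f' t) (at t)"
  shows "f' (t + T) = f' t"
proof (rule DERIV_unique)
  \<comment> \<open>The derivative of \<open>f\<close> at \<open>t + T\<close> is that of the
    translate of \<open>f\<close> at \<open>t\<close>, and the translate is \<open>f\<close>
    itself.\<close>
  show "(f has_real_derivative f' (t + T)) (at t)"
    using der[of "t + T"] by (simp add: DERIV_shift per)
qed (rule der)

lemma DERIV_arctan_div_sqrt:
  fixes w w' :: "real \<Rightarrow> real"
  assumes dw: "(w has_real_derivative w' t) (at t)" and dw': "(w' has_real_derivative w'') (at t)"
  shows "((\<lambda>t. arctan (w' t / sqrt (1 + (w t)\<^sup>2))) has_real_derivative
      (w t + w'') * (sqrt (1 + (w t)\<^sup>2) / (1 + (w t)\<^sup>2 + (w' t)\<^sup>2))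
        - w t / sqrt (1 + (w t)\<^sup>2)) (at t)"
proof -
  \<comment> \<open>Once \<open>s\<close> is a positive number with known square, what remains is
    rational algebra; \<open>D\<close> allows the denominators to be cleared.\<close>
  define s where "s = sqrt (1 + (w t)\<^sup>2)"
  have pos: "1 + (w t)\<^sup>2 > 0"
    by (simp add: add_pos_nonneg)
  have s: "s > 0" and s2: "s\<^sup>2 = 1 + (w t)\<^sup>2"
    using pos by (simp_all add: s_def)
  have D: "s\<^sup>2 + (w' t)\<^sup>2 > 0"
    using s by (simp add: add_pos_nonneg)
  have "((\<lambda>t. sqrt (1 + (w t)\<^sup>2)) has_real_derivative w t * w' t / s) (at t)"
    using pos s by (auto intro!: derivative_eq_intros dw simp: s_def field_simps)
  from DERIV_divide[OF dw' this] have "((\<lambda>t. w' t / sqrt (1 + (w t)\<^sup>2)) has_real_derivative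
      (w'' * s - w' t * (w t * w' t / s)) / (s * s)) (at t)"
    using s by (simp flip: s_def)
  from DERIV_chain2[OF DERIV_arctan this]
  have "((\<lambda>t. arctan (w' t / sqrt (1 + (w t)\<^sup>2))) has_real_derivative
      inverse (1 + (w' t / s)\<^sup>2) * ((w'' * s - w' t * (w t * w' t / s)) / (s * s))) (at t)"
    by (simp add: s_def)
  moreover have "inverse (1 + (w' t / s)\<^sup>2) = s\<^sup>2 / (s\<^sup>2 + (w' t)\<^sup>2)"
    using s D by (simp add: field_simps)
  \<comment> \<open>Over the common denominator \<open>s * (s^2 + w'^2)\<close>, both sides have
    numerator \<open>w'' * s^2 - w * w'^2\<close>.\<close>
  then have "inverse (1 + (w' t / s)\<^sup>2) * ((w'' * s - w' t * (w t * w' t / s)) / (s * s))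
      = (w t + w'') * (s / (s\<^sup>2 + (w' t)\<^sup>2)) - w t / s"
    using s D by (simp add: divide_simps) (simp add: algebra_simps power2_eq_square)
  ultimately show ?thesis
    by (simp add: s2 flip: s_def)
qed

lemma integral_periodic_width_eq:
  fixes w w' w'' :: "real \<Rightarrow> real"
  assumes dw: "\<And>t. (w has_real_derivative w' t) (at t)"
    and dw': "\<And>t. (w' has_real_derivative w'' t) (at t)"
    and per: "\<And>t. w (t + T) = w t" and T: "0 \<le> T"
  shows "integral {0..T} (\<lambda>t. w t / sqrt (1 + (w t)\<^sup>2)) =
    integral {0..T} (\<lambda>t. (w t + w'' t) * (sqrt (1 + (w t)\<^sup>2) / (1 + (w t)\<^sup>2 + (w' t)\<^sup>2)))"
    (is "integral _ ?f = integral _ ?g")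
proof -
  let ?F = "\<lambda>t. arctan (w' t / sqrt (1 + (w t)\<^sup>2))"
  have diff: "((\<lambda>t. ?g t - ?f t) has_integral ?F T - ?F 0) {0..T}"
    using T DERIV_arctan_div_sqrt[of w w', OF dw dw']
    by (intro fundamental_theorem_of_calculus)
      (auto simp: has_real_derivative_iff_has_vector_derivative
        intro: has_vector_derivative_at_within)
  have F: "?F T = ?F 0"
    using per[of 0] periodic_DERIV[OF per dw, of 0] by simp
  \<comment> \<open>Since \<open>w''\<close> is not assumed continuous, integrability of
    \<open>?g\<close> does not come from continuity. It is obtained by adding the continuous
    \<open>?f\<close> back to the difference integrated in \<open>diff\<close>.\<close>
  have "continuous_on {0..T} w"
    using dw by (meson DERIV_isCont continuous_at_imp_continuous_on)
  then have "continuous_on {0..T} ?f"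
    by (intro continuous_intros) (auto simp: add_nonneg_eq_0_iff)
  then have "(?f has_integral integral {0..T} ?f) {0..T}"
    by (intro integrable_integral integrable_continuous_real)
  from has_integral_add[OF diff this] have "(?g has_integral integral {0..T} ?f) {0..T}"
    by (simp add: F)
  then show ?thesis
    by (rule integral_unique[symmetric])
qed

theorem theorem5p22:
  fixes m k :: nat
  assumes "1 \<le> m" and "odd k" and "1 \<le> k" and "k \<le> m"
  shows "\<exists>G. residual_in (rosette_space m) G \<and>
    (\<forall>R\<in>G. \<forall>p. is_support_function m R p \<longrightarrow>
      (let w = k_width p k in
        integral {0..2 * real m * pi} (\<lambda>\<theta>. w \<theta> / sqrt (1 + (w \<theta>)\<^sup>2)) =
        integral {0..2 * real m * pi}
          (\<lambda>\<theta>. (w \<theta> + deriv (deriv w) \<theta>) *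
                (sqrt (1 + (w \<theta>)\<^sup>2) / (1 + (w \<theta>)\<^sup>2 + (deriv w \<theta>)\<^sup>2)))))"
proof (intro exI conjI ballI allI impI)
  \<comment> \<open>The witness \<open>G\<close>, left schematic by \<open>exI\<close>, is fixed
    here as the whole rosette space.\<close>
  show "residual_in (rosette_space m) (topspace (rosette_space m))"
    by (rule residual_in_topspace)
next
  fix R p assume "is_support_function m R p"
  then have "smooth p" and per: "\<And>\<theta>. p (\<theta> + 2 * real m * pi) = p \<theta>"
    by (simp_all add: is_support_function_def)
  then obtain p' p'' where dp: "\<And>t. (p has_real_derivative p' t) (at t)"
    and dp': "\<And>t. (p' has_real_derivative p'' t) (at t)"
    using smooth_DERIV_twice by blast
  note dw = DERIV_k_width[OF dp, of k] and dw' = DERIV_k_width[OF dp', of k]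
  \<comment> \<open>The \<open>deriv\<close> terms of the goal become the widths of
    \<open>p'\<close> and \<open>p''\<close>.\<close>
  have "deriv (k_width p k) = k_width p' k" "deriv (k_width p' k) = k_width p'' k"
    using dw dw' by (auto intro: DERIV_imp_deriv)
  then show "let w = k_width p k in
        integral {0..2 * real m * pi} (\<lambda>\<theta>. w \<theta> / sqrt (1 + (w \<theta>)\<^sup>2)) =
        integral {0..2 * real m * pi}
          (\<lambda>\<theta>. (w \<theta> + deriv (deriv w) \<theta>) *
                (sqrt (1 + (w \<theta>)\<^sup>2) / (1 + (w \<theta>)\<^sup>2 + (deriv w \<theta>)\<^sup>2)))"
    \<comment> \<open>The width inherits the period \<open>2 * real m * pi\<close> of
      \<open>p\<close>, which is exactly the length of the integration interval.\<close>
    using integral_periodic_width_eq[where w = "k_width p k", OF dw dw' k_width_periodic[where p = p, OF per]]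
    by (simp add: Let_def)
qed

end
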